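(* Let $N\ge 1$ be given and let $\mu_k=\Delta\tau_k/\Delta t$ for $k=0,\dots,N-1$. Assume $\hat f$ is a numerical flux consistent with $f$. Set $u_i^{(0)}=u_i^n$ and terminate the explicit Runge–Kutta pseudo-time iteration (described in the context) after $N$ steps, i.e. set $u_i^{n+1}=u_i^{(N)}$. Then the resulting scheme can be written in the locally conservative form $$\frac{u_i^{n+1}-u_i^n}{\Delta t}+\frac{1}{\Delta x}\left(\hat h^{(N)}_{i+\frac12}-\hat h^{(N)}_{i-\frac12}\right)=0,\qquad i\in\mathbb Z,$$ where $$\hat h^{(N)}_{i+\frac12}=\sum_{k=0}^{N-1}\mu_k\,b^\top(I+\mu_kA)^{-1}\left(\prod_{l=k+1}^{N-1}\phi(-\mu_l)\right)\hat{\mathbf f}^{(k)}_{i+\frac12},\qquad \hat{\mathbf f}^{(k)}_{i+\frac12}=\left(\hat f_{i+\frac12}(\mathbf U_1^{(k)}),\dots,\hat f_{i+\frac12}(\mathbf U_s^{(k)})\right)^\top,$$ is a numerical flux consistent with the flux $c(\mu_0,\dots,\mu_{N-1})f$, with $$c(\mu_0,\dots,\mu_{N-1})=1-\prod_{l=0}^{N-1}\phi(-\mu_l).$$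
   Context: Setting: the Cauchy problem for a scalar conservation law $u_t+f(u)_x=0$ on $\mathbb R$, discretized on a grid $(x_i,t_n)=(i\Delta x,n\Delta t)$, $i\in\mathbb Z$, $n\ge0$, by the implicit scheme $\frac{u_i^{n+1}-u_i^n}{\Delta t}+\frac1{\Delta x}(\hat f_{i+\frac12}(\mathbf u^{n+1})-\hat f_{i-\frac12}(\mathbf u^{n+1}))=0$, whose solution is approximated by pseudo-time iterations. Numerical flux: for fixed $p,q\in\mathbb N$, $\hat f$ is a real function of $p+q+1$ real arguments, and $\hat f_{i+\frac12}(\mathbf w)=\hat f(w_{i-p},\dots,w_{i+q})$ for $\mathbf w=(w_i)_{i\in\mathbb Z}$ (so $\hat f_{i-\frac12}$ is the same with $i$ replaced by $i-1$). A numerical flux is consistent with a function $F$ if it is Lipschitz continuous in each argument and equals $F(v)$ when all its arguments equal $v$, for every $v$. Pseudo-time iteration: given $\mathbf u^n$, put $$g_i(\mathbf w)=\frac{w_i-u_i^n}{\Delta t}+\frac{1}{\Delta x}\left(\hat f_{i+\frac12}(\mathbf w)-\hat f_{i-\frac12}(\mathbf w)\right).$$ Let $(A,b)$ be the coefficients of an explicit $s$-stage Runge–Kutta method: $A=(a_{j,l})\in\mathbb R^{s\times s}$ strictly lower triangular, $b\in\mathbb R^s$. With pseudo-time steps $\Delta\tau_k$, and for all $i\in\mathbb Z$, $$U_{j_i}^{(k)}=u_i^{(k)}-\Delta\tau_k\sum_{l=1}^{j-1}a_{j,l}\,g_i(\mathbf U_l^{(k)}),\quad j=1,\dots,s,\qquad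 u_i^{(k+1)}=u_i^{(k)}-\Delta\tau_k\sum_{j=1}^s b_j\,g_i(\mathbf U_j^{(k)}),$$ where $\mathbf U_j^{(k)}=(U_{j_i}^{(k)})_{i\in\mathbb Z}$. The stability function is $\phi(z)=1+z\,b^\top(I-zA)^{-1}\mathbf 1$, with $\mathbf 1=(1,\dots,1)^\top\in\mathbb R^s$ and $I$ the $s\times s$ identity. Empty products equal $1$. Since $\mathbf u^{(0)}=\mathbf u^n$, the quantity $\hat h^{(N)}_{i+\frac12}$ is (for fixed $\Delta x,\Delta t,\mu_0,\dots,\mu_{N-1}$) a function of finitely many entries $u^n_{i'}$ of $\mathbf u^n$ with $i'$ in a finite stencil around $i$; the arguments of the numerical flux $\hat h^{(N)}_{i+\frac12}$ are these entries. *)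

theory Defs
  imports "HOL-Analysis.Analysis"
begin

text \<open>
  Grid functions are maps \<open>w :: int \<Rightarrow> real\<close>. A numerical flux with stencil \<open>(p, q)\<close> is a function
  \<open>F :: real list \<Rightarrow> real\<close> of which only the values on lists of length \<open>p + q + 1\<close> matter.
  Interface values \<open>i + 1/2\<close> are indexed by \<open>i\<close>, so that \<open>i - 1/2\<close> is index \<open>i - 1\<close>.
\<close>

definition flux_at :: "nat \<Rightarrow> nat \<Rightarrow> (real list \<Rightarrow> real) \<Rightarrow> (int \<Rightarrow> real) \<Rightarrow> int \<Rightarrow> real" where
  "flux_at p q F w i = F (map w [i - int p..i + int q])"

text \<open>
  The Lipschitz constant in the \<open>m\<close>-th argument is uniform in the remaining arguments.
\<close>

definition consistent_flux :: "nat \<Rightarrow> nat \<Rightarrow> (real list \<Rightarrow> real) \<Rightarrow> (real \<Rightarrow> real) \<Rightarrow> bool" where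
  "consistent_flux p q F f \<longleftrightarrow>
     (\<forall>m < p + q + 1. \<exists>L. \<forall>xs. length xs = p + q + 1 \<longrightarrow>
        L-lipschitz_on UNIV (\<lambda>a. F (xs[m := a]))) \<and>
     (\<forall>v. F (replicate (p + q + 1) v) = f v)"

definition residual ::
  "nat \<Rightarrow> nat \<Rightarrow> (real list \<Rightarrow> real) \<Rightarrow> real \<Rightarrow> real \<Rightarrow> (int \<Rightarrow> real) \<Rightarrow> (int \<Rightarrow> real) \<Rightarrow> int \<Rightarrow> real" where
  "residual p q F dx dt un w i =
     (w i - un i) / dt + 1 / dx * (flux_at p q F w i - flux_at p q F w (i - 1))"

text \<open>
  The stages are indexed by a finite well-ordered type \<open>'s\<close>, so \<open>s = CARD('s)\<close>.
\<close>

definition strictly_lower_triangular :: "real ^ 's::{finite,wellorder} ^ 's::{finite,wellorder} \<Rightarrow> bool" where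
  "strictly_lower_triangular A \<longleftrightarrow> (\<forall>j l. j \<le> l \<longrightarrow> A $ j $ l = 0)"

function rk_stage ::
  "real ^ 's::{finite,wellorder} ^ 's::{finite,wellorder} \<Rightarrow> real \<Rightarrow> ((int \<Rightarrow> real) \<Rightarrow> int \<Rightarrow> real) \<Rightarrow>
   (int \<Rightarrow> real) \<Rightarrow> 's::{finite,wellorder} \<Rightarrow> int \<Rightarrow> real" where
  "rk_stage A dtau g u j =
     (\<lambda>i. u i - dtau * (\<Sum>l \<in> {..<j}. A $ j $ l * g (rk_stage A dtau g u l) i))"
  by pat_completeness auto
termination
  by (relation "inv_image {(x, y). x < y} (\<lambda>(A, dtau, g, u, j). j)") (auto simp: wf)

declare rk_stage.simps [simp del]

definition rk_step ::
  "real ^ 's::{finite,wellorder} ^ 's::{finite,wellorder} \<Rightarrow> real ^ 's::{finite,wellorder} \<Rightarrow> real \<Rightarrow>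
   ((int \<Rightarrow> real) \<Rightarrow> int \<Rightarrow> real) \<Rightarrow> (int \<Rightarrow> real) \<Rightarrow> int \<Rightarrow> real" where
  "rk_step A b dtau g u i = u i - dtau * (\<Sum>j\<in>UNIV. b $ j * g (rk_stage A dtau g u j) i)"

primrec rk_iterate ::
  "real ^ 's::{finite,wellorder} ^ 's::{finite,wellorder} \<Rightarrow> real ^ 's::{finite,wellorder} \<Rightarrow> (nat \<Rightarrow> real) \<Rightarrow>
   ((int \<Rightarrow> real) \<Rightarrow> int \<Rightarrow> real) \<Rightarrow> (int \<Rightarrow> real) \<Rightarrow> nat \<Rightarrow> int \<Rightarrow> real" where
  "rk_iterate A b dtau g u0 0 = u0"
| "rk_iterate A b dtau g u0 (Suc k) = rk_step A b (dtau k) g (rk_iterate A b dtau g u0 k)"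

text \<open>
  In \<open>real ^ 's\<close>, the constant \<open>1\<close> is the vector all of whose components are \<open>1\<close>;
  the identity matrix is \<open>mat 1\<close>.
\<close>

definition stability_function :: "real ^ 's ^ 's \<Rightarrow> real ^ 's \<Rightarrow> real \<Rightarrow> real" where
  "stability_function A b z = 1 + z * (b \<bullet> (matrix_inv (mat 1 - z *\<^sub>R A) *v 1))"

definition stage_fluxes ::
  "real ^ 's::{finite,wellorder} ^ 's::{finite,wellorder} \<Rightarrow> real ^ 's::{finite,wellorder} \<Rightarrow> nat \<Rightarrow> nat \<Rightarrow> (real list \<Rightarrow> real) \<Rightarrow>
   real \<Rightarrow> real \<Rightarrow> (nat \<Rightarrow> real) \<Rightarrow> (int \<Rightarrow> real) \<Rightarrow> nat \<Rightarrow> int \<Rightarrow> real ^ 's::{finite,wellorder}" where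
  "stage_fluxes A b p q F dx dt dtau un k i =
     (let g = residual p q F dx dt un
      in \<chi> j. flux_at p q F (rk_stage A (dtau k) g (rk_iterate A b dtau g un k) j) i)"

definition iterated_flux ::
  "real ^ 's::{finite,wellorder} ^ 's::{finite,wellorder} \<Rightarrow> real ^ 's::{finite,wellorder} \<Rightarrow> nat \<Rightarrow> nat \<Rightarrow> (real list \<Rightarrow> real) \<Rightarrow>
   real \<Rightarrow> real \<Rightarrow> (nat \<Rightarrow> real) \<Rightarrow> (nat \<Rightarrow> real) \<Rightarrow> nat \<Rightarrow> (int \<Rightarrow> real) \<Rightarrow> int \<Rightarrow> real" where
  "iterated_flux A b p q F dx dt dtau mu N un i =
     (\<Sum>k<N. mu k * (b \<bullet> (matrix_inv (mat 1 + mu k *\<^sub>R A) *v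
        ((\<Prod>l\<in>{k + 1..<N}. stability_function A b (- mu l)) *\<^sub>R
          stage_fluxes A b p q F dx dt dtau un k i))))"

end

theory Submission
  imports Defs
begin

text \<open>
  Conservation. Within one Runge--Kutta step, let \<open>G\<close> be the vector of the stage residuals at
  a grid point \<open>i\<close>, let \<open>\<Phi> i\<close> be the vector of the stage fluxes at the interface \<open>i\<close>, and write
  \<open>e = (u i - un i) / dt\<close> for the scaled distance from the old time level. The residual is affine
  in the pointwise value of its argument and in the flux difference, so that eliminating the stage
  values from the definition of the stages leaves the linear system
  \<open>(I + m A) G = e 1 + (\<Phi> i - \<Phi> (i - 1)) / dx\<close>; the system matrix is unit lower triangular,
  hence invertible (\<open>stage_residuals_solve_linear_system\<close>). The update \<open>u - m dt (b \<bullet> G)\<close> therefore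
  multiplies \<open>e\<close> by \<open>1 - m b \<bullet> (I + m A)\<inverse> 1\<close>, which is the stability function at \<open>- m\<close>, and
  subtracts a difference of interface quantities (\<open>rk_step_increment\<close>). Since \<open>e\<close> vanishes
  initially, unrolling this scalar recurrence (\<open>linear_recurrence_unroll\<close>) expresses the final \<open>e\<close>
  as exactly the flux difference asserted.

  Consistency on constants. On constant data all flux differences vanish, so the pseudo-time
  iteration stays put and every stage flux equals \<open>f v\<close>. The weights of the iterated flux are then
  \<open>(1 - \<phi> k)\<close> times the product of the later \<open>\<phi> l\<close>, and their sum telescopes to one minus the
  product of all \<open>\<phi> l\<close> (\<open>iterated_flux_const\<close>).

  Finite stencil and Lipschitz continuity. Both follow together from one closure argument. Call an
  operator on grid functions a grid operator if it commutes with translations and if its value at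
  \<open>i\<close> varies by at most a constant times the \<open>l\<^sup>1\<close> distance of the arguments over a fixed window
  around \<open>i\<close>. Applying a numerical flux is a grid operator, and grid operators are closed under
  linear combinations and composition, hence contain all stages, iterates and the iterated
  flux (\<open>grid_operator_iterated_flux\<close>). Conversely, a grid operator
  cannot see anything outside its window, so it is given by a numerical flux on that window
  (\<open>grid_operator_imp_flux\<close>).
\<close>

section \<open>One pseudo-time step as a scalar recurrence\<close>

lemma invertible_one_plus_strictly_lower_triangular:
  fixes A :: "real ^ 's::{finite,wellorder} ^ 's::{finite,wellorder}"
  assumes "strictly_lower_triangular A"
  shows "invertible (mat 1 + m *\<^sub>R A)"
proof -
  have "det (mat 1 + m *\<^sub>R A) = (\<Prod>j\<in>UNIV. (mat 1 + m *\<^sub>R A) $ j $ j)"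
    by (rule det_lowerdiagonal)
      (use assms in \<open>auto simp: strictly_lower_triangular_def mat_def\<close>)
  also have "\<dots> = 1"
    using assms by (simp add: strictly_lower_triangular_def mat_def)
  finally show ?thesis
    by (simp add: invertible_det_nz)
qed

text \<open>
  The stages recurse over earlier stages only; the sum over all stages is what makes the
  coefficients act as a matrix.
\<close>

lemma rk_stage_full_sum:
  assumes "strictly_lower_triangular A"
  shows "rk_stage A d g u j i = u i - d * (\<Sum>l\<in>UNIV. A $ j $ l * g (rk_stage A d g u l) i)"
proof -
  have "(\<Sum>l<j. A $ j $ l * g (rk_stage A d g u l) i) =
        (\<Sum>l\<in>UNIV. A $ j $ l * g (rk_stage A d g u l) i)"
    by (rule sum.mono_neutral_left)
      (use assms in \<open>auto simp: strictly_lower_triangular_def not_less\<close>)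
  then show ?thesis
    by (subst rk_stage.simps) simp
qed

text \<open>
  A row of the claimed system results from inserting the stage value
  \<open>U j i = u i - m dt (A G) j\<close> into the residual: the term \<open>(U j i - un i) / dt\<close> contributes
  \<open>- m (A G) j\<close>, which moves to the left-hand side. The fluxes depend on the stages
  nonlinearly, but they enter only as a known right-hand side.
\<close>

lemma stage_residuals_solve_linear_system:
  fixes A :: "real ^ 's::{finite,wellorder} ^ 's::{finite,wellorder}"
    and u un :: "int \<Rightarrow> real" and m dt :: real
  assumes A: "strictly_lower_triangular A" and dt: "dt \<noteq> 0"
    and g: "g = residual p q F dx dt un"
  defines "U \<equiv> rk_stage A (m * dt) g u"
  defines "\<Phi> \<equiv> (\<lambda>i. \<chi> j. flux_at p q F (U j) i)"
  shows "(\<chi> j. g (U j) i) = matrix_inv (mat 1 + m *\<^sub>R A) *v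
           (((u i - un i) / dt) *\<^sub>R 1 + (1 / dx) *\<^sub>R (\<Phi> i - \<Phi> (i - 1)))"
proof -
  let ?M = "mat 1 + m *\<^sub>R A" and ?G = "\<chi> j. g (U j) i"
  let ?rhs = "((u i - un i) / dt) *\<^sub>R 1 + (1 / dx) *\<^sub>R (\<Phi> i - \<Phi> (i - 1))"
  have "?M *v ?G = ?rhs"
  proof (rule vec_eq_iff[THEN iffD2], rule allI)
    fix j
    have "U j i = u i - m * dt * ((A *v ?G) $ j)"
      unfolding U_def using A
      by (subst rk_stage_full_sum) (simp_all add: matrix_vector_mult_def)
    then have "?G $ j = (u i - un i) / dt - m * ((A *v ?G) $ j)
                 + 1 / dx * (\<Phi> i $ j - \<Phi> (i - 1) $ j)"
      using dt by (simp add: g residual_def \<Phi>_def field_simps)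
    moreover have "(?M *v ?G) $ j = ?G $ j + m * ((A *v ?G) $ j)"
      by (simp add: matrix_vector_mult_add_rdistrib scaleR_matrix_vector_assoc[symmetric])
    ultimately show "(?M *v ?G) $ j = ?rhs $ j"
      by (simp add: algebra_simps)
  qed
  then have "matrix_inv ?M *v ?rhs = (matrix_inv ?M ** ?M) *v ?G"
    by (simp only: matrix_vector_mul_assoc[symmetric])
  also have "matrix_inv ?M ** ?M = mat 1"
    using someI_ex[OF invertible_one_plus_strictly_lower_triangular[OF A, of m, unfolded invertible_def]]
    by (simp add: matrix_inv_def)
  finally show ?thesis by simp
qed

text \<open>
  The pointwise increment and the flux difference separate: the former is scaled by the stability
  function, the latter is a difference of one quantity at two neighbouring interfaces.
\<close>

lemma rk_step_increment:
  fixes A :: "real ^ 's::{finite,wellorder} ^ 's::{finite,wellorder}"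
    and u un :: "int \<Rightarrow> real" and m dt :: real
  assumes A: "strictly_lower_triangular A" and dt: "dt \<noteq> 0"
    and g: "g = residual p q F dx dt un"
  defines "\<Phi> \<equiv> (\<lambda>i. \<chi> j. flux_at p q F (rk_stage A (m * dt) g u j) i)"
  shows "(rk_step A b (m * dt) g u i - un i) / dt =
           stability_function A b (- m) * ((u i - un i) / dt)
           - 1 / dx * (m * (b \<bullet> (matrix_inv (mat 1 + m *\<^sub>R A) *v (\<Phi> i - \<Phi> (i - 1)))))"
proof -
  let ?K = "matrix_inv (mat 1 + m *\<^sub>R A)"
  have "rk_step A b (m * dt) g u i
          = u i - m * dt * (b \<bullet> (\<chi> j. g (rk_stage A (m * dt) g u j) i))"
    by (simp add: rk_step_def inner_vec_def)
  also have "\<dots> = u i - m * dt * ((u i - un i) / dt * (b \<bullet> (?K *v 1))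
               + 1 / dx * (b \<bullet> (?K *v (\<Phi> i - \<Phi> (i - 1)))))"
    unfolding stage_residuals_solve_linear_system[OF A dt g, where m = m and u = u and i = i]
    by (simp add: \<Phi>_def matrix_vector_right_distrib inner_right_distrib matrix_vector_mult_scaleR)
  finally have step: "rk_step A b (m * dt) g u i = \<dots>" .
  show ?thesis
    unfolding step stability_function_def
    using dt by (simp add: diff_divide_distrib add_divide_distrib algebra_simps)
qed

section \<open>Conservative form\<close>

text \<open>
  The contribution subtracted in step \<open>k\<close> is amplified by all later factors. This serves twice:
  for the increments of the scheme, and for the telescoping sum that determines the
  consistency constant.
\<close>

lemma linear_recurrence_unroll:
  fixes e a c :: "nat \<Rightarrow> 'a::comm_ring_1"
  assumes "e 0 = 0" and "\<And>k. k < N \<Longrightarrow> e (Suc k) = a k * e k - c k"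
  shows "e N = - (\<Sum>k<N. c k * (\<Prod>l\<in>{k+1..<N}. a l))"
  using assms(2)
proof (induction N)
  case 0
  then show ?case using assms(1) by simp
next
  case (Suc N)
  have "(\<Sum>k<N. c k * (\<Prod>l\<in>{k+1..<Suc N}. a l)) = a N * (\<Sum>k<N. c k * (\<Prod>l\<in>{k+1..<N}. a l))"
    by (simp add: sum_distrib_left mult_ac)
  with Suc show ?case by simp
qed

lemma iterated_flux_alt:
  "iterated_flux A b p q F dx dt dtau mu N un i =
     (\<Sum>k<N. (mu k * (b \<bullet> (matrix_inv (mat 1 + mu k *\<^sub>R A) *v
        stage_fluxes A b p q F dx dt dtau un k i)))
        * (\<Prod>l\<in>{k + 1..<N}. stability_function A b (- mu l)))"
  by (simp add: iterated_flux_def matrix_vector_mult_scaleR mult_ac)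

text \<open>
  The recurrence of \<open>rk_step_increment\<close> starts from \<open>0\<close> because the iteration is initialised with
  the old time level itself; this is why the old data disappear and only flux differences remain.
\<close>

lemma iterated_scheme_conservative:
  fixes A :: "real ^ 's::{finite,wellorder} ^ 's::{finite,wellorder}"
  assumes A: "strictly_lower_triangular A" and dt: "dt \<noteq> 0"
    and mu: "\<And>k. k < N \<Longrightarrow> mu k = dtau k / dt"
  shows "(rk_iterate A b dtau (residual p q F dx dt un) un N i - un i) / dt
           + 1 / dx * (iterated_flux A b p q F dx dt dtau mu N un i
                       - iterated_flux A b p q F dx dt dtau mu N un (i - 1)) = 0"
proof -
  let ?g = "residual p q F dx dt un"
  let ?\<Phi> = "stage_fluxes A b p q F dx dt dtau un"
  define e where "e k = (rk_iterate A b dtau ?g un k i - un i) / dt" for k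
  define c where "c k j = mu k * (b \<bullet> (matrix_inv (mat 1 + mu k *\<^sub>R A) *v ?\<Phi> k j))" for k j
  have "e N = - (\<Sum>k<N. 1 / dx * (c k i - c k (i - 1)) * (\<Prod>l\<in>{k+1..<N}. stability_function A b (- mu l)))"
  proof (rule linear_recurrence_unroll)
    show "e 0 = 0" by (simp add: e_def)
  next
    fix k assume "k < N"
    then have "dtau k = mu k * dt" using mu dt by simp
    then show "e (Suc k) = stability_function A b (- mu k) * e k - 1 / dx * (c k i - c k (i - 1))"
      using rk_step_increment[OF A dt refl, where m = "mu k" and u = "rk_iterate A b dtau ?g un k" and i = i
          and b = b and p = p and q = q and F = F and dx = dx and un = un]
      by (simp add: e_def c_def stage_fluxes_def Let_def matrix_vector_mult_diff_distrib inner_diff_right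
          right_diff_distrib)
  qed
  then show ?thesis
    by (simp add: e_def iterated_flux_alt c_def[symmetric] sum_distrib_left left_diff_distrib right_diff_distrib
        sum_subtractf mult.assoc diff_divide_distrib sum_divide_distrib)
qed

section \<open>Constant data\<close>

lemma rk_stage_fixed_point:
  assumes "\<And>i. g u i = 0"
  shows "rk_stage A d g u j = u"
proof (induction j rule: less_induct)
  case (less j)
  then show ?case
    by (subst rk_stage.simps) (simp add: assms)
qed

lemma rk_iterate_fixed_point:
  assumes "\<And>i. g u i = 0"
  shows "rk_iterate A b dtau g u k = u"
  by (induction k) (auto simp: rk_step_def rk_stage_fixed_point[of g, OF assms] assms)

lemma flux_at_const: "flux_at p q F (\<lambda>_. v) i = F (replicate (p + q + 1) v)"
proof -
  have "length [i - int p..i + int q] = p + q + 1" by simp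
  then show ?thesis
    unfolding flux_at_def map_replicate_const by (simp only:)
qed

text \<open>
  By definition \<open>m b \<bullet> (I + m A)\<inverse> 1\<close> is one minus the stability function at \<open>- m\<close>, so on
  constant data the weights of the iterated flux form a telescoping sum.
\<close>

lemma iterated_flux_const:
  assumes "F (replicate (p + q + 1) v) = y"
  shows "iterated_flux A b p q F dx dt dtau mu N (\<lambda>_. v) i
           = (1 - (\<Prod>l\<in>{0..<N}. stability_function A b (- mu l))) * y"
proof -
  let ?s = "\<lambda>l. stability_function A b (- mu l)"
  have fa: "flux_at p q F (\<lambda>_. v) j = y" for j
    using assms by (simp only: flux_at_const)
  then have "residual p q F dx dt (\<lambda>_. v) (\<lambda>_. v) j = 0" for j
    by (simp add: residual_def)
  then have "stage_fluxes A b p q F dx dt dtau (\<lambda>_. v) k i = y *\<^sub>R 1" for k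
    by (simp add: stage_fluxes_def rk_iterate_fixed_point rk_stage_fixed_point fa vec_eq_iff)
  then have "iterated_flux A b p q F dx dt dtau mu N (\<lambda>_. v) i
               = y * (\<Sum>k<N. (1 - ?s k) * (\<Prod>l\<in>{k+1..<N}. ?s l))"
    by (simp add: iterated_flux_alt stability_function_def matrix_vector_mult_scaleR
        sum_distrib_left mult_ac)
  also have "(\<Sum>k<N. (1 - ?s k) * (\<Prod>l\<in>{k+1..<N}. ?s l)) = 1 - (\<Prod>l\<in>{0..<N}. ?s l)"
    \<comment> \<open>the partial products minus one start at zero and obey \<open>e (k + 1) = ?s k * e k - (1 - ?s k)\<close>\<close>
    using linear_recurrence_unroll[of "\<lambda>k. (\<Prod>l\<in>{0..<k}. ?s l) - 1" N ?s "\<lambda>k. 1 - ?s k"]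
    by (simp add: algebra_simps)
  finally show ?thesis by simp
qed

section \<open>Translation-invariant Lipschitz operators of finite range\<close>

text \<open>
  A single \<open>l\<^sup>1\<close> bound over a window encodes two facts at once: dependence on finitely many entries
  (equal arguments on the window give equal values) and Lipschitz continuity in each entry,
  uniformly in the others. In this form it is preserved by composition. Translation
  invariance ensures that the same function of the entries is used at every grid point.
\<close>

definition grid_operator :: "((int \<Rightarrow> real) \<Rightarrow> int \<Rightarrow> real) \<Rightarrow> bool" where
  "grid_operator T \<longleftrightarrow>
     (\<forall>v i k. T (\<lambda>j. v (j + k)) i = T v (i + k)) \<and>
     (\<exists>R L. 0 \<le> L \<and>
        (\<forall>v w i. \<bar>T v i - T w i\<bar> \<le> L * (\<Sum>j\<in>{i - int R..i + int R}. \<bar>v j - w j\<bar>)))"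

lemma grid_operatorI:
  assumes "\<And>v i k. T (\<lambda>j. v (j + k)) i = T v (i + k)" and "0 \<le> L"
    and "\<And>v w i. \<bar>T v i - T w i\<bar> \<le> L * (\<Sum>j\<in>{i - int R..i + int R}. \<bar>v j - w j\<bar>)"
  shows "grid_operator T"
  using assms unfolding grid_operator_def by blast

lemma grid_operator_shift:
  "grid_operator T \<Longrightarrow> T (\<lambda>j. v (j + k)) i = T v (i + k)"
  unfolding grid_operator_def by blast

lemma grid_operator_bound:
  assumes "grid_operator T"
  obtains R L where "0 \<le> L"
    "\<And>v w i. \<bar>T v i - T w i\<bar> \<le> L * (\<Sum>j\<in>{i - int R..i + int R}. \<bar>v j - w j\<bar>)"
  using assms unfolding grid_operator_def by blast

lemma grid_operator_id: "grid_operator (\<lambda>v i. v i)"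
  by (rule grid_operatorI[where L = 1 and R = 0]) auto

lemma grid_operator_const: "grid_operator (\<lambda>v i. c)"
  by (rule grid_operatorI[where L = 0 and R = 0]) auto

lemma grid_operator_cmult:
  assumes "grid_operator T"
  shows "grid_operator (\<lambda>v i. c * T v i)"
proof -
  obtain R L where L: "0 \<le> L"
    "\<And>v w i. \<bar>T v i - T w i\<bar> \<le> L * (\<Sum>j\<in>{i - int R..i + int R}. \<bar>v j - w j\<bar>)"
    using grid_operator_bound[OF assms] by metis
  show ?thesis
  proof (rule grid_operatorI[where L = "\<bar>c\<bar> * L" and R = R])
    fix v w i
    show "\<bar>c * T v i - c * T w i\<bar> \<le> \<bar>c\<bar> * L * (\<Sum>j\<in>{i - int R..i + int R}. \<bar>v j - w j\<bar>)"
      using mult_left_mono[OF L(2)[of v i w], of "\<bar>c\<bar>"]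
      by (simp add: right_diff_distrib[symmetric] abs_mult mult.assoc)
  next
    fix v i k
    show "c * T (\<lambda>j. v (j + k)) i = c * T v (i + k)"
      by (simp only: grid_operator_shift[OF assms, of v k i])
  qed (use L(1) in simp)
qed

lemma grid_operator_add:
  assumes "grid_operator S" and "grid_operator T"
  shows "grid_operator (\<lambda>v i. S v i + T v i)"
proof -
  obtain R L where L: "0 \<le> L"
    "\<And>v w i. \<bar>S v i - S w i\<bar> \<le> L * (\<Sum>j\<in>{i - int R..i + int R}. \<bar>v j - w j\<bar>)"
    using grid_operator_bound[OF assms(1)] by metis
  obtain R' L' where L': "0 \<le> L'"
    "\<And>v w i. \<bar>T v i - T w i\<bar> \<le> L' * (\<Sum>j\<in>{i - int R'..i + int R'}. \<bar>v j - w j\<bar>)"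
    using grid_operator_bound[OF assms(2)] by metis
  show ?thesis
  proof (rule grid_operatorI[where L = "L + L'" and R = "max R R'"])
    fix v w :: "int \<Rightarrow> real" and i
    let ?\<Sigma> = "\<lambda>R. \<Sum>j\<in>{i - int R..i + int R}. \<bar>v j - w j\<bar>"
    have "?\<Sigma> R \<le> ?\<Sigma> (max R R')" "?\<Sigma> R' \<le> ?\<Sigma> (max R R')"
      by (auto intro!: sum_mono2)
    then have "L * ?\<Sigma> R \<le> L * ?\<Sigma> (max R R')" "L' * ?\<Sigma> R' \<le> L' * ?\<Sigma> (max R R')"
      using L(1) L'(1) by (simp_all add: mult_left_mono)
    then show "\<bar>S v i + T v i - (S w i + T w i)\<bar> \<le> (L + L') * ?\<Sigma> (max R R')"
      using L(2)[of v i w] L'(2)[of v i w] unfolding distrib_right by linarith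
  next
    fix v i k
    show "S (\<lambda>j. v (j + k)) i + T (\<lambda>j. v (j + k)) i = S v (i + k) + T v (i + k)"
      by (simp only: grid_operator_shift[OF assms(1), of v k i] grid_operator_shift[OF assms(2), of v k i])
  qed (use L(1) L'(1) in simp)
qed

lemma grid_operator_diff:
  assumes "grid_operator S" and "grid_operator T"
  shows "grid_operator (\<lambda>v i. S v i - T v i)"
  using grid_operator_add[OF assms(1) grid_operator_cmult[OF assms(2), of "-1"]] by simp

lemma grid_operator_sum:
  assumes "\<And>k. k \<in> K \<Longrightarrow> grid_operator (T k)"
  shows "grid_operator (\<lambda>v i. \<Sum>k\<in>K. T k v i)"
  using assms
  by (induction K rule: infinite_finite_induct)
    (simp_all add: grid_operator_const grid_operator_add)

lemma grid_operator_translate: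
  assumes "grid_operator T"
  shows "grid_operator (\<lambda>v i. T v (i - 1))"
proof -
  obtain R L where L: "0 \<le> L"
    "\<And>v w i. \<bar>T v i - T w i\<bar> \<le> L * (\<Sum>j\<in>{i - int R..i + int R}. \<bar>v j - w j\<bar>)"
    using grid_operator_bound[OF assms] by metis
  show ?thesis
  proof (rule grid_operatorI[where L = L and R = "Suc R"])
    fix v w :: "int \<Rightarrow> real" and i
    have "(\<Sum>j\<in>{i - 1 - int R..i - 1 + int R}. \<bar>v j - w j\<bar>)
            \<le> (\<Sum>j\<in>{i - int (Suc R)..i + int (Suc R)}. \<bar>v j - w j\<bar>)"
      by (rule sum_mono2) auto
    then show "\<bar>T v (i - 1) - T w (i - 1)\<bar>
                 \<le> L * (\<Sum>j\<in>{i - int (Suc R)..i + int (Suc R)}. \<bar>v j - w j\<bar>)"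
      using L(2)[of v "i - 1" w] mult_left_mono L(1) order_trans by meson
  next
    fix v i k
    show "T (\<lambda>j. v (j + k)) (i - 1) = T v (i + k - 1)"
      using grid_operator_shift[OF assms, of v k "i - 1"] by (simp only: diff_add_eq)
  qed (rule L(1))
qed

text \<open>
  The radii add. Each of the \<open>2 R + 1\<close> values of \<open>T\<close> that \<open>S\<close> reads is controlled by the same
  sum over the enlarged window, which gives the product of the constants times \<open>2 R + 1\<close>.
\<close>

lemma grid_operator_compose:
  assumes "grid_operator S" and "grid_operator T"
  shows "grid_operator (\<lambda>v. S (T v))"
proof -
  obtain R L where L: "0 \<le> L"
    "\<And>v w i. \<bar>S v i - S w i\<bar> \<le> L * (\<Sum>j\<in>{i - int R..i + int R}. \<bar>v j - w j\<bar>)"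
    using grid_operator_bound[OF assms(1)] by metis
  obtain R' L' where L': "0 \<le> L'"
    "\<And>v w i. \<bar>T v i - T w i\<bar> \<le> L' * (\<Sum>j\<in>{i - int R'..i + int R'}. \<bar>v j - w j\<bar>)"
    using grid_operator_bound[OF assms(2)] by metis
  show ?thesis
  proof (rule grid_operatorI[where L = "L * (real (2 * R + 1) * L')" and R = "R + R'"])
    fix v :: "int \<Rightarrow> real" and i k
    have "T (\<lambda>j. v (j + k)) = (\<lambda>i. T v (i + k))"
      by (rule ext) (rule grid_operator_shift[OF assms(2)])
    then show "S (T (\<lambda>j. v (j + k))) i = S (T v) (i + k)"
      by (simp only: grid_operator_shift[OF assms(1), of "T v" k i])
  next
    fix v w :: "int \<Rightarrow> real" and i
    let ?D = "\<Sum>j\<in>{i - int (R + R')..i + int (R + R')}. \<bar>v j - w j\<bar>"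
    have "(\<Sum>j\<in>{i - int R..i + int R}. \<bar>T v j - T w j\<bar>) \<le> (\<Sum>j\<in>{i - int R..i + int R}. L' * ?D)"
    proof (rule sum_mono)
      fix j assume "j \<in> {i - int R..i + int R}"
      then have "(\<Sum>j\<in>{j - int R'..j + int R'}. \<bar>v j - w j\<bar>) \<le> ?D"
        by (intro sum_mono2) auto
      then show "\<bar>T v j - T w j\<bar> \<le> L' * ?D"
        using L'(2)[of v j w] mult_left_mono L'(1) order_trans by meson
    qed
    also have "\<dots> = real (2 * R + 1) * L' * ?D"
      by (simp add: nat_add_distrib)
    finally show "\<bar>S (T v) i - S (T w) i\<bar> \<le> L * (real (2 * R + 1) * L') * ?D"
      using L(2)[of "T v" i "T w"] mult_left_mono[OF _ L(1)] order_trans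
      unfolding mult.assoc by meson
  qed (use L(1) L'(1) in simp)
qed

section \<open>Numerical fluxes and grid operators\<close>

text \<open>
  Argumentwise Lipschitz bounds that are uniform in the other arguments combine to a joint bound:
  exchange the entries of \<open>xs\<close> for those of \<open>ys\<close> one at a time, from the left.
\<close>

lemma lipschitz_jointly:
  fixes F :: "real list \<Rightarrow> real"
  assumes "\<And>m. m < n \<Longrightarrow> \<exists>L. \<forall>xs. length xs = n \<longrightarrow> L-lipschitz_on UNIV (\<lambda>a. F (xs[m := a]))"
  obtains L where "0 \<le> L"
    "\<And>xs ys. length xs = n \<Longrightarrow> length ys = n \<Longrightarrow>
       \<bar>F xs - F ys\<bar> \<le> L * (\<Sum>m<n. \<bar>xs ! m - ys ! m\<bar>)"
proof -
  obtain \<Lambda> where \<Lambda>: "\<And>m xs. m < n \<Longrightarrow> length xs = n \<Longrightarrow>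
      (\<Lambda> m)-lipschitz_on UNIV (\<lambda>a. F (xs[m := a]))"
    using assms by metis
  define L where "L = (\<Sum>m<n. \<bar>\<Lambda> m\<bar>)"
  have le: "\<Lambda> m \<le> L" if "m < n" for m
  proof -
    have "\<Lambda> m \<le> \<bar>\<Lambda> m\<bar>" by simp
    also have "\<dots> \<le> L"
      unfolding L_def by (rule member_le_sum) (use that in auto)
    finally show ?thesis .
  qed
  show ?thesis
  proof
    show "0 \<le> L" by (simp add: L_def sum_nonneg)
  next
    fix xs ys :: "real list" assume len: "length xs = n" "length ys = n"
    have "\<bar>F xs - F (take k ys @ drop k xs)\<bar> \<le> L * (\<Sum>m<k. \<bar>xs ! m - ys ! m\<bar>)" if "k \<le> n" for k
      using that
    proof (induction k)
      case (Suc k)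
      let ?z = "take k ys @ drop k xs"
      have eq: "?z[k := xs ! k] = ?z" "?z[k := ys ! k] = take (Suc k) ys @ drop (Suc k) xs"
        using Suc.prems len
        by (auto intro!: nth_equalityI simp: nth_append nth_list_update less_Suc_eq min_def)
      have "dist (F (?z[k := xs ! k])) (F (?z[k := ys ! k])) \<le> \<Lambda> k * dist (xs ! k) (ys ! k)"
        by (rule lipschitz_onD[OF \<Lambda>]) (use Suc.prems len in auto)
      also have "\<dots> \<le> L * \<bar>xs ! k - ys ! k\<bar>"
        using le[of k] Suc.prems by (simp add: dist_real_def mult_right_mono)
      finally show ?case
        using Suc unfolding eq by (simp add: dist_real_def algebra_simps)
    qed simp
    from this[of n] show "\<bar>F xs - F ys\<bar> \<le> L * (\<Sum>m<n. \<bar>xs ! m - ys ! m\<bar>)"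
      using len by simp
  qed
qed

lemma grid_operator_flux_at:
  assumes "consistent_flux p q F f"
  shows "grid_operator (flux_at p q F)"
proof -
  let ?n = "p + q + 1"
  obtain L where L: "0 \<le> L"
    "\<And>xs ys. length xs = ?n \<Longrightarrow> length ys = ?n \<Longrightarrow>
       \<bar>F xs - F ys\<bar> \<le> L * (\<Sum>m<?n. \<bar>xs ! m - ys ! m\<bar>)"
  proof (rule lipschitz_jointly[of ?n F])
    fix m assume "m < ?n"
    with assms show "\<exists>L. \<forall>xs. length xs = ?n \<longrightarrow> L-lipschitz_on UNIV (\<lambda>a. F (xs[m := a]))"
      unfolding consistent_flux_def by blast
  qed (use that in blast)
  show ?thesis
  proof (rule grid_operatorI[where L = L and R = "p + q"])
    fix v :: "int \<Rightarrow> real" and i k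
    have "map (\<lambda>j. v (j + k)) [i - int p..i + int q] = map v [i + k - int p..i + k + int q]"
      by (rule nth_equalityI) (auto simp: algebra_simps)
    then show "flux_at p q F (\<lambda>j. v (j + k)) i = flux_at p q F v (i + k)"
      by (simp add: flux_at_def)
  next
    fix v w :: "int \<Rightarrow> real" and i
    let ?xs = "\<lambda>v. map v [i - int p..i + int q]"
    have "\<bar>flux_at p q F v i - flux_at p q F w i\<bar> \<le> L * (\<Sum>m<?n. \<bar>?xs v ! m - ?xs w ! m\<bar>)"
      unfolding flux_at_def by (rule L(2)) auto
    also have "(\<Sum>m<?n. \<bar>?xs v ! m - ?xs w ! m\<bar>) = (\<Sum>j\<in>{i - int p..i + int q}. \<bar>v j - w j\<bar>)"
      by (rule sum.reindex_bij_witness[where i = "\<lambda>j. nat (j - (i - int p))"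
            and j = "\<lambda>m. i - int p + int m"]) auto
    also have "L * \<dots> \<le> L * (\<Sum>j\<in>{i - int (p + q)..i + int (p + q)}. \<bar>v j - w j\<bar>)"
      by (intro mult_left_mono sum_mono2 L(1)) auto
    finally show "\<bar>flux_at p q F v i - flux_at p q F w i\<bar>
        \<le> L * (\<Sum>j\<in>{i - int (p + q)..i + int (p + q)}. \<bar>v j - w j\<bar>)" .
  qed (rule L(1))
qed

text \<open>
  The flux evaluates \<open>T\<close> at \<open>0\<close> on the grid function that carries the given list on
  \<open>{- R..R}\<close>. What this grid function is elsewhere does not matter, because the bound
  for \<open>T\<close> ignores everything outside the window.
\<close>

lemma grid_operator_imp_flux:
  assumes "grid_operator T"
  obtains R H where "\<And>v i. T v i = flux_at R R H v i"
    "consistent_flux R R H (\<lambda>v. T (\<lambda>_. v) 0)"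
proof -
  obtain R L where L: "0 \<le> L"
    "\<And>v w i. \<bar>T v i - T w i\<bar> \<le> L * (\<Sum>j\<in>{i - int R..i + int R}. \<bar>v j - w j\<bar>)"
    using grid_operator_bound[OF assms] by metis
  define grid :: "real list \<Rightarrow> int \<Rightarrow> real" where "grid xs j = xs ! nat (j + int R)" for xs j
  define H where "H xs = T (grid xs) 0" for xs
  have rep: "T v i = flux_at R R H v i" for v i
  proof -
    let ?g = "grid (map v [i - int R..i + int R])"
    have "(\<Sum>j\<in>{0 - int R..0 + int R}. \<bar>v (j + i) - ?g j\<bar>) = 0"
      by (rule sum.neutral) (auto simp: grid_def algebra_simps)
    then have "T (\<lambda>j. v (j + i)) 0 = T ?g 0"
      using L(2)[of "\<lambda>j. v (j + i)" 0 ?g] by simp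
    then show ?thesis
      by (simp only: flux_at_def H_def grid_operator_shift[OF assms, of v i 0] add_0)
  qed
  moreover have "L-lipschitz_on UNIV (\<lambda>a. H (xs[m := a]))"
    if m: "m < R + R + 1" and len: "length xs = R + R + 1" for m xs
  proof (rule lipschitz_onI)
    fix a b :: real
    let ?d = "\<lambda>j. \<bar>grid (xs[m := a]) j - grid (xs[m := b]) j\<bar>"
    have "(\<Sum>j\<in>{0 - int R..0 + int R}. ?d j) = (\<Sum>j\<in>{int m - int R}. ?d j)"
      by (rule sum.mono_neutral_right) (use m len in \<open>auto simp: grid_def nth_list_update split: if_splits\<close>)
    also have "\<dots> = dist a b"
      using m len by (simp add: grid_def dist_real_def)
    finally show "dist (H (xs[m := a])) (H (xs[m := b])) \<le> L * dist a b"
      using L(2)[of "grid (xs[m := a])" 0 "grid (xs[m := b])"]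
      by (simp add: H_def dist_real_def)
  qed (rule L(1))
  moreover have "H (replicate (R + R + 1) v) = T (\<lambda>_. v) 0" for v
    using rep[of "\<lambda>_. v" 0] by (simp only: flux_at_const)
  ultimately show ?thesis
    using that unfolding consistent_flux_def by blast
qed

section \<open>The iterated flux is a numerical flux\<close>

context
  fixes p q :: nat and F :: "real list \<Rightarrow> real" and f :: "real \<Rightarrow> real"
  assumes F: "consistent_flux p q F f"
begin

text \<open>
  The residual depends on the old time level \<open>un\<close> both explicitly and through its argument, so
  grid operators are composed here with everything regarded as a function of \<open>un\<close>.
\<close>

lemma grid_operator_residual:
  assumes "grid_operator W"
  shows "grid_operator (\<lambda>un. residual p q F dx dt un (W un))"
proof -
  have "grid_operator (\<lambda>un i. 1 / dt * (W un i - un i) + 1 / dx *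
          (flux_at p q F (W un) i - flux_at p q F (W un) (i - 1)))"
    using grid_operator_compose[OF grid_operator_flux_at[OF F] assms]
    by (intro grid_operator_add grid_operator_cmult grid_operator_diff grid_operator_id
        grid_operator_translate assms)
  then show ?thesis
    by (simp add: residual_def[abs_def])
qed

lemma grid_operator_rk_stage:
  assumes "grid_operator W"
  shows "grid_operator (\<lambda>un. rk_stage A d (residual p q F dx dt un) (W un) j)"
proof (induction j rule: less_induct)
  case (less j)
  then show ?case
    by (subst rk_stage.simps)
      (intro grid_operator_diff grid_operator_cmult grid_operator_sum grid_operator_residual assms, simp)
qed

lemma grid_operator_rk_iterate:
  "grid_operator (\<lambda>un. rk_iterate A b dtau (residual p q F dx dt un) un k)"
proof (induction k)
  case 0
  then show ?case by (simp add: grid_operator_id)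
next
  case (Suc k)
  then show ?case
    unfolding rk_iterate.simps rk_step_def[abs_def]
    by (intro grid_operator_diff grid_operator_cmult grid_operator_sum grid_operator_residual
        grid_operator_rk_stage)
qed

lemma grid_operator_iterated_flux:
  "grid_operator (\<lambda>un i. iterated_flux A b p q F dx dt dtau mu N un i)"
proof -
  have "grid_operator (\<lambda>un i. stage_fluxes A b p q F dx dt dtau un k i $ j)" for k j
    unfolding stage_fluxes_def Let_def vec_lambda_beta
    by (intro grid_operator_compose[OF grid_operator_flux_at[OF F]]
        grid_operator_rk_stage grid_operator_rk_iterate)
  then show ?thesis
    unfolding iterated_flux_def inner_vec_def matrix_vector_mult_def vec_lambda_beta
      vector_scaleR_component inner_real_def real_scaleR_def
    by (intro grid_operator_cmult grid_operator_sum) 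
qed

end

theorem theorem5:
  fixes A :: "real ^ 's::{finite,wellorder} ^ 's::{finite,wellorder}" and b :: "real ^ 's::{finite,wellorder}"
    and p q N :: nat
    and F :: "real list \<Rightarrow> real" and f :: "real \<Rightarrow> real"
    and dx dt :: real and dtau mu :: "nat \<Rightarrow> real"
  assumes "strictly_lower_triangular A"
    and "dx > 0" and "dt > 0"
    and "N \<ge> 1"
    and "\<And>k. k < N \<Longrightarrow> mu k = dtau k / dt"
    and "consistent_flux p q F f"
  shows "(\<forall>un unew. (\<forall>i. unew i = rk_iterate A b dtau (residual p q F dx dt un) un N i) \<longrightarrow>
            (\<forall>i. (unew i - un i) / dt
               + 1 / dx * (iterated_flux A b p q F dx dt dtau mu N un i
                           - iterated_flux A b p q F dx dt dtau mu N un (i - 1)) = 0))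
       \<and> (\<exists>P Q H.
            (\<forall>un i. iterated_flux A b p q F dx dt dtau mu N un i = flux_at P Q H un i)
          \<and> consistent_flux P Q H
              (\<lambda>v. (1 - (\<Prod>l\<in>{0..<N}. stability_function A b (- mu l))) * f v))"
proof (intro conjI allI impI)
  fix un unew i
  assume "\<forall>i. unew i = rk_iterate A b dtau (residual p q F dx dt un) un N i"
  then show "(unew i - un i) / dt
               + 1 / dx * (iterated_flux A b p q F dx dt dtau mu N un i
                           - iterated_flux A b p q F dx dt dtau mu N un (i - 1)) = 0"
    using iterated_scheme_conservative[OF assms(1) _ assms(5)] assms(3) by simp
next
  let ?T = "\<lambda>un i. iterated_flux A b p q F dx dt dtau mu N un i"
  obtain R H where "\<And>v i. ?T v i = flux_at R R H v i"
    and "consistent_flux R R H (\<lambda>v. ?T (\<lambda>_. v) 0)"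
    using grid_operator_imp_flux[OF grid_operator_iterated_flux[OF assms(6)]] by blast
  moreover have "?T (\<lambda>_. v) 0 = (1 - (\<Prod>l\<in>{0..<N}. stability_function A b (- mu l))) * f v" for v
    by (rule iterated_flux_const) (use assms(6) in \<open>simp only: consistent_flux_def\<close>)
  ultimately show "\<exists>P Q H. (\<forall>un i. ?T un i = flux_at P Q H un i)
          \<and> consistent_flux P Q H
              (\<lambda>v. (1 - (\<Prod>l\<in>{0..<N}. stability_function A b (- mu l))) * f v)"
    by auto
qed

end
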